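(* For all $d \geq 3$, there exist normal, orientable (simplicial) $(d-1)$-pseudomanifolds $X$ and $Y$ such that $\mathscr{F}_0^{d-2}(X) \cong \mathscr{F}_0^{d-2}(Y)$ as posets, but $\mathscr{F}(X) \not\cong \mathscr{F}(Y)$ as posets.
   Context: All simplicial complexes are finite. For a simplicial complex $X$, $\mathscr{F}(X)$ is the poset of all faces of $X$ (including the empty face) ordered by containment, $\mathscr{F}^k(X)$ is the set of $k$-dimensional faces, and for $a \le b$, $\mathscr{F}_a^b(X) := \bigcup_{k=a}^b \mathscr{F}^k(X)$ with the induced partial order. Faces are identified with their vertex sets. For a face $G$ of $X$, the link $\operatorname{Lk}(G,X)$ is the subcomplex with faces $\{A \setminus G : A \in \mathscr{F}(X), G \subseteq A\}$. A simplicial $(d-1)$-pseudomanifold is a $(d-1)$-dimensional simplicial complex that is pure (every face is contained in a $(d-1)$-face, called a facet) and in which every $(d-2)$-face is contained in exactly two facets. A simplicial $(d-1)$-pseudomanifold $X$ is normal if it is connected and $\operatorname{Lk}(G,X)$ is connected for every $k$-face $G$ with $0 \le k \le d-3$. It is orientable if its facets can be oriented so that, for every $(d-2)$-face, the two facets containing it induce opposite orientations on it. The symbol $\cong$ denotes isomorphism of posets. *)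

theory Defs
  imports "HOL-Combinatorics.Permutations"
begin

text \<open>
  A finite abstract simplicial complex is the set of its faces, each face being its vertex set.
  The empty face is included, so the face poset \<open>\<F>(X)\<close> is \<open>X\<close> itself, ordered by inclusion.
\<close>

definition simplicial_complex :: "'v set set \<Rightarrow> bool" where
  "simplicial_complex X \<longleftrightarrow>
     finite X \<and> (\<forall>A\<in>X. finite A) \<and> {} \<in> X \<and> (\<forall>A\<in>X. \<forall>B. B \<subseteq> A \<longrightarrow> B \<in> X)"

text \<open>Dimensions are integers because the empty face has dimension \<open>-1\<close>.\<close>

definition face_dim :: "'v set \<Rightarrow> int" where
  "face_dim A = int (card A) - 1"

definition complex_dim :: "'v set set \<Rightarrow> int" where
  "complex_dim X = Max (face_dim ` X)"

definition faces :: "int \<Rightarrow> 'v set set \<Rightarrow> 'v set set" where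
  "faces k X = {A \<in> X. face_dim A = k}"

definition faces_between :: "int \<Rightarrow> int \<Rightarrow> 'v set set \<Rightarrow> 'v set set" where
  "faces_between a b X = (\<Union>k\<in>{a..b}. faces k X)"

definition link :: "'v set \<Rightarrow> 'v set set \<Rightarrow> 'v set set" where
  "link G X = {A - G | A. A \<in> X \<and> G \<subseteq> A}"

text \<open>Any two vertices are joined by an edge path.\<close>

definition complex_connected :: "'v set set \<Rightarrow> bool" where
  "complex_connected X \<longleftrightarrow>
     (\<forall>u\<in>\<Union>X. \<forall>v\<in>\<Union>X. (u, v) \<in> {(x, y). {x, y} \<in> X}\<^sup>*)"

definition pure_complex :: "int \<Rightarrow> 'v set set \<Rightarrow> bool" where
  "pure_complex n X \<longleftrightarrow> (\<forall>A\<in>X. \<exists>F\<in>faces n X. A \<subseteq> F)"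

definition pseudomanifold :: "int \<Rightarrow> 'v set set \<Rightarrow> bool" where
  "pseudomanifold n X \<longleftrightarrow>
     simplicial_complex X \<and> complex_dim X = n \<and> pure_complex n X \<and>
     (\<forall>G\<in>faces (n - 1) X. card {F \<in> faces n X. G \<subseteq> F} = 2)"

definition normal_pseudomanifold :: "int \<Rightarrow> 'v set set \<Rightarrow> bool" where
  "normal_pseudomanifold n X \<longleftrightarrow>
     pseudomanifold n X \<and> complex_connected X \<and>
     (\<forall>k\<in>{0..n - 2}. \<forall>G\<in>faces k X. complex_connected (link G X))"

text \<open>
  An orientation of a simplex with at least two vertices is one of the two classes of orderings
  of its vertices modulo even permutations.
\<close>

definition vertex_orderings :: "'v set \<Rightarrow> 'v list set" where
  "vertex_orderings A = {xs. distinct xs \<and> set xs = A}"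

definition even_reordering :: "'v set \<Rightarrow> ('v list \<times> 'v list) set" where
  "even_reordering A =
     {(xs, ys). xs \<in> vertex_orderings A \<and> (\<exists>p. p permutes A \<and> evenperm p \<and> ys = map p xs)}"

definition orientations :: "'v set \<Rightarrow> 'v list set set" where
  "orientations A = vertex_orderings A // even_reordering A"

definition opposite_orientation :: "'v set \<Rightarrow> 'v list set \<Rightarrow> 'v list set" where
  "opposite_orientation A \<omega> = vertex_orderings A - \<omega>"

text \<open>
  The usual boundary convention: the orientation \<open>[v, v\<^sub>1, \<dots>, v\<^sub>n]\<close> of a simplex induces
  \<open>[v\<^sub>1, \<dots>, v\<^sub>n]\<close> on the face opposite to \<open>v\<close>.
\<close>

definition induced_orientation :: "'v set \<Rightarrow> 'v list set \<Rightarrow> 'v list set" where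
  "induced_orientation G \<omega> = {xs. set xs = G \<and> (\<exists>v. v # xs \<in> \<omega>)}"

text \<open>Intended for \<open>n \<ge> 2\<close>: a single vertex has only one class of orderings.\<close>

definition orientable :: "int \<Rightarrow> 'v set set \<Rightarrow> bool" where
  "orientable n X \<longleftrightarrow>
     (\<exists>or. (\<forall>F\<in>faces n X. or F \<in> orientations F) \<and>
       (\<forall>G\<in>faces (n - 1) X. \<forall>F\<in>faces n X. \<forall>F'\<in>faces n X.
          F \<noteq> F' \<and> G \<subseteq> F \<and> G \<subseteq> F' \<longrightarrow>
          induced_orientation G (or F) =
            opposite_orientation G (induced_orientation G (or F'))))"

definition poset_isomorphic :: "'a::order set \<Rightarrow> 'b::order set \<Rightarrow> bool" where
  "poset_isomorphic P Q \<longleftrightarrow>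
     (\<exists>f. bij_betw f P Q \<and> (\<forall>x\<in>P. \<forall>y\<in>P. x \<le> y \<longleftrightarrow> f x \<le> f y))"

end

theory Submission
  imports Defs
begin

text \<open>
  Take \<open>d\<close> colours with five vertices each and let every facet contain one vertex of each colour.
  A set of such facets is a pseudomanifold as soon as each choice of vertices in \<open>d - 1\<close> of the
  colours extends to exactly two facets, for instance when the facets form the union of two
  disjoint Latin hypercubes \<open>L\<^sub>0\<close> and \<open>L\<^sub>1\<close> of order five. All complexes of this kind have the same
  \<open>(d - 2)\<close>-skeleton: its faces are the sets of fewer than \<open>d\<close> vertices of different colours. They
  are orientable, because adjacent facets lie in different hypercubes
  (\<open>balanced_alternating_orientable\<close>). So it suffices to find two such pairs of hypercubes that
  give normal, non-isomorphic complexes.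

  With vertices labelled by residues modulo 5, let \<open>L\<^sub>0\<close> consist of the transversals with sum 0, and
  let \<open>L\<^sub>1\<close> be obtained from \<open>L\<^sub>0\<close> by relabelling colour 0 along a cyclic permutation \<open>\<rho>\<close> of the
  five residues: a transversal lies in \<open>L\<^sub>1\<close> if replacing its vertex \<open>z\<close> of colour 0 by \<open>\<rho> z\<close> makes
  the sum 0. As \<open>\<rho>\<close> has no fixed point, \<open>L\<^sub>0\<close> and \<open>L\<^sub>1\<close> are disjoint. The link of a face missing at
  least three colours contains a complete multipartite graph, and the link of a face missing exactly
  two colours is a single cycle of length ten, because two steps along it act on the vertices of one
  colour as a five-cycle (\<open>\<rho>\<close>, or a nonzero translation). Hence the complex is normal
  (\<open>link_connected\<close>).

  If \<open>\<rho>\<close> is the rotation \<open>k \<mapsto> k + 1\<close>, then the facets are the transversals whose sum is 0 or \<open>-1\<close>.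
  Crossing a ridge of a given colour changes the vertex of that colour by \<open>+1\<close> or \<open>-1\<close>, depending
  only on the current sum; so when a vertex of one colour is exchanged, then vertices of two other
  colours, and then the first colour again, the initial vertex returns (\<open>rotation_path_closes\<close>). For
  a five-cycle \<open>\<rho>\<close> for which \<open>\<rho> k - k\<close> is not constant this fails, and an explicit path of five
  facets shows it. An isomorphism of face posets is induced by a map of vertices
  (\<open>face_poset_isomorphism_vertex_map\<close>) and would transport that path.
\<close>

section \<open>Orientations of simplices\<close>

definition even_class :: "'v set \<Rightarrow> 'v list \<Rightarrow> 'v list set" where
  "even_class A s = {map p s | p. p permutes A \<and> evenperm p}"

lemma permutation_of_finite:
  assumes "finite A" "p permutes A"
  shows "permutation p"
  using assms by (metis permutation_permutes)

lemma vertex_orderings_map: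
  assumes "s \<in> vertex_orderings A" "p permutes A"
  shows "map p s \<in> vertex_orderings A"
  using assms permutes_image[OF assms(2)] permutes_inj_on[OF assms(2)]
  by (simp add: vertex_orderings_def distinct_map)

lemma map_permutation_unique:
  assumes "s \<in> vertex_orderings A" "p permutes A" "q permutes A" "map p s = map q s"
  shows "p = q"
proof
  fix x
  show "p x = q x"
  proof (cases "x \<in> A")
    case True
    then have "x \<in> set s" using assms(1) by (simp add: vertex_orderings_def)
    then show ?thesis using assms(4) by (simp only: map_eq_conv)
  next
    case False
    then show ?thesis using permutes_not_in[OF assms(2)] permutes_not_in[OF assms(3)] by simp
  qed
qed

lemma vertex_orderings_eq_map:
  assumes "s \<in> vertex_orderings A" "xs \<in> vertex_orderings A"
  obtains p where "p permutes A" "xs = map p s"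
proof -
  have ds: "distinct s" "set s = A" and dx: "distinct xs" "set xs = A"
    using assms by (auto simp: vertex_orderings_def)
  have len: "length s = length xs"
    using ds dx by (metis distinct_card)
  define p where "p x = (if x \<in> A then the (map_of (zip s xs) x) else x)" for x
  have p_nth: "p (s ! i) = xs ! i" if "i < length s" for i
    using that ds len by (auto simp: p_def map_of_zip_nth)
  have map: "xs = map p s"
    by (rule nth_equalityI) (use len p_nth in auto)
  have "bij_betw p A A"
    using map ds dx by (metis bij_betw_def distinct_map list.set_map)
  then have "p permutes A"
    by (rule bij_imp_permutes) (simp add: p_def)
  then show thesis using map that by blast
qed

lemma even_class_orientation:
  assumes "s \<in> vertex_orderings A"
  shows "even_class A s \<in> orientations A"
proof -
  have "even_class A s = even_reordering A `` {s}"
    using assms by (auto simp: even_class_def even_reordering_def)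
  then show ?thesis
    using assms unfolding orientations_def quotient_def by blast
qed

text \<open>
  A transposition of two vertices turns the even reorderings of \<open>s\<close> into the odd ones; two vertices
  must be available for it.
\<close>

lemma odd_class_orientation:
  assumes s: "s \<in> vertex_orderings A" and "card A \<ge> 2"
  shows "vertex_orderings A - even_class A s \<in> orientations A"
proof -
  have fin: "finite A" using assms(2) by (metis card.infinite not_numeral_le_zero)
  obtain a b where ab: "a \<in> A" "b \<in> A" "a \<noteq> b"
    using assms(2) fin by (metis card_2_iff' card_le_Suc0_iff_eq not_less_eq_eq numeral_2_eq_2)
  define t where "t = transpose a b"
  have t: "t permutes A" "permutation t" "\<not> evenperm t" "t \<circ> t = id"
    using ab by (auto simp: t_def permutes_swap_id permutation_swap_id evenperm_swap)
  have "vertex_orderings A - even_class A s = even_class A (map t s)"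
  proof (intro equalityI subsetI)
    fix xs assume xs: "xs \<in> vertex_orderings A - even_class A s"
    then obtain p where p: "p permutes A" "xs = map p s"
      using s vertex_orderings_eq_map by blast
    then have "\<not> evenperm p" using xs unfolding even_class_def by blast
    then have "evenperm (p \<circ> t)"
      using evenperm_comp[OF permutation_of_finite[OF fin p(1)] t(2)] t(3) by blast
    moreover have "xs = map (p \<circ> t) (map t s)"
      using p t(4) by (simp add: fun_eq_iff)
    moreover have "(p \<circ> t) permutes A" using p t by (simp add: permutes_compose)
    ultimately show "xs \<in> even_class A (map t s)"
      unfolding even_class_def by blast
  next
    fix xs assume "xs \<in> even_class A (map t s)"
    then obtain q where q: "q permutes A" "evenperm q" "xs = map (q \<circ> t) s"
      by (auto simp: even_class_def)
    have qt: "(q \<circ> t) permutes A" using q t by (simp add: permutes_compose)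
    have "\<not> evenperm (q \<circ> t)"
      using evenperm_comp[OF permutation_of_finite[OF fin q(1)] t(2)] q(2) t(3) by blast
    moreover have "p = q \<circ> t" if "p permutes A" "xs = map p s" for p
      using map_permutation_unique[OF s that(1) qt] that(2) q(3) by metis
    ultimately have "xs \<notin> even_class A s"
      unfolding even_class_def by blast
    then show "xs \<in> vertex_orderings A - even_class A s"
      using q(3) vertex_orderings_map[OF s qt] by simp
  qed
  then show ?thesis
    using even_class_orientation vertex_orderings_map[OF s t(1)] by metis
qed

text \<open>
  Conjugating \<open>p\<close> by a transposition preserves its parity, so exchanging one vertex for another
  carries orientations of a simplex to orientations of the neighbouring simplex.
\<close>

lemma even_class_transport:
  fixes v v' :: 'v
  assumes fin: "finite F" and ys: "ys \<in> even_class F s"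
  defines "t \<equiv> transpose v v'"
  shows "map t ys \<in> even_class (t ` F) (map t s)"
proof -
  obtain p where p: "p permutes F" "evenperm p" "ys = map p s"
    using ys by (auto simp: even_class_def)
  have t: "permutation t" "t \<circ> t = id"
    by (auto simp: t_def permutation_swap_id)
  have tt: "t (t x) = x" for x using t(2) by (simp add: fun_eq_iff)
  define q where "q = t \<circ> p \<circ> t"
  have pp: "permutation p" using fin p permutation_of_finite by blast
  have "evenperm q"
    using t p pp by (auto simp: q_def evenperm_comp permutation_compose)
  moreover have "q permutes t ` F"
  proof (rule bij_imp_permutes)
    show "bij_betw q (t ` F) (t ` F)"
      unfolding q_def
    proof (intro bij_betw_trans)
      show "bij_betw t (t ` F) F"
        by (rule bij_betw_byWitness[where f' = t]) (auto simp: tt)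
      show "bij_betw p F F" using p permutes_imp_bij by blast
      show "bij_betw t F (t ` F)"
        by (rule bij_betw_byWitness[where f' = t]) (auto simp: tt)
    qed
  next
    fix x assume "x \<notin> t ` F"
    then have "t x \<notin> F" using tt by (metis imageI)
    then show "q x = x" using p by (simp add: q_def permutes_not_in tt)
  qed
  moreover have "map t ys = map q (map t s)"
    using p t(2) by (simp add: q_def fun_eq_iff)
  ultimately show ?thesis by (auto simp: even_class_def)
qed

lemma induced_opposite_orientation:
  assumes "\<omega> \<subseteq> vertex_orderings (insert v G)" "v \<notin> G"
  shows "induced_orientation G (opposite_orientation (insert v G) \<omega>) =
         opposite_orientation G (induced_orientation G \<omega>)"
proof -
  have v: "u = v" if "u # xs \<in> vertex_orderings (insert v G)" "set xs = G" for u xs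
    using that assms(2) unfolding vertex_orderings_def
    by (metis (mono_tags, lifting) distinct.simps(2) insert_iff list.simps(15) mem_Collect_eq)
  have cons: "v # xs \<in> vertex_orderings (insert v G) \<longleftrightarrow> xs \<in> vertex_orderings G"
    if "set xs = G" for xs
    using that assms(2) by (auto simp: vertex_orderings_def)
  have "xs \<in> induced_orientation G (opposite_orientation (insert v G) \<omega>) \<longleftrightarrow>
      xs \<in> opposite_orientation G (induced_orientation G \<omega>)" (is "?l \<longleftrightarrow> ?r") for xs
  proof (cases "set xs = G")
    case True
    have "?l \<longleftrightarrow> v # xs \<in> vertex_orderings (insert v G) \<and> v # xs \<notin> \<omega>"
      using True v[of _ xs] by (auto simp: induced_orientation_def opposite_orientation_def)
    moreover have "?r \<longleftrightarrow> xs \<in> vertex_orderings G \<and> v # xs \<notin> \<omega>"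
      using True v[of _ xs] assms(1)
      unfolding induced_orientation_def opposite_orientation_def by blast
    ultimately show ?thesis using cons[OF True] by blast
  next
    case False
    then show ?thesis
      by (auto simp: induced_orientation_def opposite_orientation_def vertex_orderings_def)
  qed
  then show ?thesis by blast
qed

definition colour_list :: "('v \<Rightarrow> nat) \<Rightarrow> nat \<Rightarrow> 'v set \<Rightarrow> 'v list" where
  "colour_list col m F = map (inv_into F col) [0..<m]"

lemma colour_list_ordering:
  assumes "bij_betw col F {..<m}"
  shows "colour_list col m F \<in> vertex_orderings F"
proof -
  have "bij_betw (inv_into F col) {..<m} F"
    using assms by (rule bij_betw_inv_into)
  then show ?thesis
    by (auto simp: colour_list_def vertex_orderings_def distinct_map bij_betw_def
        lessThan_atLeast0)
qed

lemma colour_list_exchange: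
  assumes F: "bij_betw col (insert v G) {..<m}" and F': "bij_betw col (insert v' G) {..<m}"
    and "v \<notin> G" "v' \<notin> G"
  shows "map (transpose v v') (colour_list col m (insert v G)) = colour_list col m (insert v' G)"
proof -
  have "col ` G = {..<m} - {col v}" "col ` G = {..<m} - {col v'}"
    using F F' assms(3,4) by (simp_all add: bij_betw_def) (metis Diff_insert_absorb)+
  moreover have "col v < m" "col v' < m"
    using F F' by (auto simp: bij_betw_def)
  ultimately have cv: "col v = col v'" by auto
  have "transpose v v' (inv_into (insert v G) col i) = inv_into (insert v' G) col i"
    if i: "i < m" for i
  proof -
    have "i \<in> col ` insert v G"
      using F i by (metis bij_betw_imp_surj_on lessThan_iff)
    then obtain u where u: "u \<in> insert v G" "col u = i" by blast
    have 1: "inv_into (insert v G) col i = u"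
      using bij_betw_inv_into_left[OF F u(1)] u(2) by simp
    have u': "transpose v v' u \<in> insert v' G" "col (transpose v v' u) = i"
    proof -
      have "u = v \<and> transpose v v' u = v' \<or> u \<in> G \<and> transpose v v' u = u"
        using u(1) assms(3,4) by (metis insertE transpose_apply_first transpose_apply_other)
      then show "transpose v v' u \<in> insert v' G" "col (transpose v v' u) = i"
        using u(2) cv by (elim disjE conjE; simp)+
    qed
    have "inv_into (insert v' G) col i = transpose v v' u"
      using bij_betw_inv_into_left[OF F' u'(1)] u'(2) by simp
    then show ?thesis using 1 by simp
  qed
  then show ?thesis by (simp add: colour_list_def)
qed

text \<open>
  Since \<open>v\<close> and \<open>v'\<close> have the same colour, the transposition maps one colour list to the other while
  fixing the ridge pointwise. The reverse inclusion is the same statement with \<open>v\<close> and \<open>v'\<close> exchanged.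
\<close>

lemma induced_colour_orientation:
  assumes F: "bij_betw col (insert v G) {..<m}" and F': "bij_betw col (insert v' G) {..<m}"
    and "v \<notin> G" "v' \<notin> G"
  shows "induced_orientation G (even_class (insert v G) (colour_list col m (insert v G)))
       \<subseteq> induced_orientation G (even_class (insert v' G) (colour_list col m (insert v' G)))"
proof
  let ?t = "transpose v v'"
  fix xs assume "xs \<in> induced_orientation G (even_class (insert v G) (colour_list col m (insert v G)))"
  then obtain u where u: "set xs = G"
      "u # xs \<in> even_class (insert v G) (colour_list col m (insert v G))"
    by (auto simp: induced_orientation_def)
  have "u # xs \<in> vertex_orderings (insert v G)"
    using u(2) colour_list_ordering[OF F] vertex_orderings_map by (fastforce simp: even_class_def)
  then have "u = v"
    using u(1) \<open>v \<notin> G\<close> by (auto simp: vertex_orderings_def)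
  moreover have "map ?t xs = xs"
    using u(1) assms(3,4) by (intro map_idI) (metis transpose_apply_other)
  ultimately have tu: "map ?t (u # xs) = v' # xs" by simp
  have img: "?t ` insert v G = insert v' G"
  proof -
    have "?t ` G = G"
      using assms(3,4) by (intro image_cong[THEN trans, OF refl _ image_ident])
        (metis transpose_apply_other)
    then show ?thesis by simp
  qed
  have fin: "finite (insert v G)" using bij_betw_finite[OF F] by simp
  have "map ?t (u # xs) \<in> even_class (?t ` insert v G) (map ?t (colour_list col m (insert v G)))"
    using fin u(2) by (rule even_class_transport)
  then have "v' # xs \<in> even_class (insert v' G) (colour_list col m (insert v' G))"
    unfolding tu img colour_list_exchange[OF assms(1-4)] .
  then show "xs \<in> induced_orientation G (even_class (insert v' G) (colour_list col m (insert v' G)))"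
    using u(1) unfolding induced_orientation_def by blast
qed

lemma facet_insert_ridge:
  assumes "finite F" "G \<subseteq> F" "card F = Suc (card G)"
  obtains v where "F = insert v G" "v \<notin> G"
proof -
  have "card (F - G) = 1"
    using assms by (simp add: card_Diff_subset finite_subset)
  then obtain v where "F - G = {v}" by (meson card_1_singletonE)
  then have "F = insert v G" "v \<notin> G" using assms(2) by auto
  then show thesis by (rule that)
qed

text \<open>
  When every facet carries each of the \<open>m\<close> colours once, listing its vertices in the order of
  their colours is a reference orientation. Exchanging a vertex across a ridge keeps its position
  in the list, so the reference orientations of two adjacent facets induce the same orientation
  on the ridge. Reversing the reference orientation on one of two classes of facets is therefore
  a coherent orientation as soon as adjacent facets lie in different classes.
\<close>

lemma balanced_alternating_orientable:
  fixes col :: "'v \<Rightarrow> nat" and m :: nat and sg :: "'v set \<Rightarrow> bool"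
  assumes "m \<ge> 2"
    and bij: "\<And>F. F \<in> faces (int m - 1) X \<Longrightarrow> bij_betw col F {..<m}"
    and alt: "\<And>G F F'. \<lbrakk>G \<in> faces (int m - 2) X; F \<in> faces (int m - 1) X; F' \<in> faces (int m - 1) X;
              F \<noteq> F'; G \<subseteq> F; G \<subseteq> F'\<rbrakk> \<Longrightarrow> sg F \<noteq> sg F'"
  shows "orientable (int m - 1) X"
proof -
  define E where "E F = even_class F (colour_list col m F)" for F
  define ori where "ori F = (if sg F then E F else opposite_orientation F (E F))" for F
  have E_sub: "E F \<subseteq> vertex_orderings F" if "bij_betw col F {..<m}" for F
    using colour_list_ordering[OF that] vertex_orderings_map
    by (fastforce simp: E_def even_class_def)
  have "ori F \<in> orientations F" if F: "F \<in> faces (int m - 1) X" for F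
  proof -
    have "card F = m" using bij[OF F] by (simp add: bij_betw_same_card)
    then show ?thesis
      using colour_list_ordering[OF bij[OF F]] \<open>m \<ge> 2\<close>
      by (simp add: ori_def E_def opposite_orientation_def even_class_orientation
          odd_class_orientation)
  qed
  moreover have "induced_orientation G (ori F) =
      opposite_orientation G (induced_orientation G (ori F'))"
    if G: "G \<in> faces (int m - 1 - 1) X" and F: "F \<in> faces (int m - 1) X" "F' \<in> faces (int m - 1) X"
      and ne: "F \<noteq> F'" "G \<subseteq> F" "G \<subseteq> F'" for G F F'
  proof -
    have b: "bij_betw col F {..<m}" "bij_betw col F' {..<m}" using bij F by auto
    then have fin: "finite F" "finite F'" and cards: "card F = m" "card F' = m"
      using bij_betw_finite[OF b(1)] bij_betw_finite[OF b(2)] bij_betw_same_card by fastforce+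
    have cG: "Suc (card G) = m" using G \<open>m \<ge> 2\<close> by (auto simp: faces_def face_dim_def)
    obtain v v' where v: "F = insert v G" "F' = insert v' G" "v \<notin> G" "v' \<notin> G"
      using facet_insert_ridge[of F G] facet_insert_ridge[of F' G] fin ne(2,3) cards cG by metis
    have "sg F \<noteq> sg F'" using alt[of G F F'] G F ne by simp
    have same: "induced_orientation G (E F) = induced_orientation G (E F')"
      using induced_colour_orientation[OF b[unfolded v(1,2)] v(3,4)]
        induced_colour_orientation[OF b(2,1)[unfolded v(1,2)] v(4,3)]
      by (simp add: E_def v(1,2))
    have opp: "induced_orientation G (opposite_orientation F (E F)) =
        opposite_orientation G (induced_orientation G (E F))"
      using induced_opposite_orientation[of "E F" v G] E_sub[OF b(1)] v by simp
    have opp': "induced_orientation G (opposite_orientation F' (E F')) =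
        opposite_orientation G (induced_orientation G (E F'))"
      using induced_opposite_orientation[of "E F'" v' G] E_sub[OF b(2)] v by simp
    have "xs \<in> vertex_orderings G" if xs: "xs \<in> induced_orientation G (E F)" for xs
    proof -
      obtain u where "u # xs \<in> vertex_orderings F" "set xs = G"
        using xs E_sub[OF b(1)] unfolding induced_orientation_def by blast
      then show ?thesis by (auto simp: vertex_orderings_def)
    qed
    then have "opposite_orientation G (opposite_orientation G (induced_orientation G (E F))) =
        induced_orientation G (E F)"
      by (auto simp: opposite_orientation_def)
    then show ?thesis
      using \<open>sg F \<noteq> sg F'\<close> same opp opp' by (cases "sg F") (simp_all add: ori_def)
  qed
  ultimately show ?thesis unfolding orientable_def by blast
qed

section \<open>Isomorphisms of face posets\<close>

text \<open>
  The empty face is the least element and the vertices are the atoms, so the isomorphism preserves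
  both; and a face is determined by the atoms below it.
\<close>

lemma face_poset_isomorphism_vertex_map:
  assumes X: "simplicial_complex X" and Y: "simplicial_complex Y"
    and f: "bij_betw f X Y" and ord: "\<forall>A\<in>X. \<forall>B\<in>X. A \<subseteq> B \<longleftrightarrow> f A \<subseteq> f B"
  shows "\<exists>\<phi>. inj_on \<phi> (\<Union>X) \<and> (\<forall>A\<in>X. f A = \<phi> ` A)"
proof -
  have fX: "f A \<in> Y" if "A \<in> X" for A using f that by (auto simp: bij_betw_def)
  have down: "B \<in> X" if "A \<in> X" "B \<subseteq> A" for A B
    using X that by (auto simp: simplicial_complex_def)
  have downY: "B \<in> Y" if "A \<in> Y" "B \<subseteq> A" for A B
    using Y that by (auto simp: simplicial_complex_def)
  have surj: "\<exists>A\<in>X. f A = B" if "B \<in> Y" for B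
    using f that by (auto simp: bij_betw_def)
  have empty: "f {} = {}"
  proof -
    have "{} \<in> X" "{} \<in> Y" using X Y by (auto simp: simplicial_complex_def)
    then obtain A where "A \<in> X" "f A = {}" using surj by blast
    then show ?thesis using ord \<open>{} \<in> X\<close> by blast
  qed
  have inj: "A = B" if "A \<in> X" "B \<in> X" "f A = f B" for A B
    using f that by (auto simp: bij_betw_def inj_on_def)
  have single: "\<exists>w. f {v} = {w}" if v: "{v} \<in> X" for v
  proof -
    have E: "{} \<in> X" using X by (auto simp: simplicial_complex_def)
    have "f {v} \<noteq> {}" using inj[OF v E] empty by auto
    then obtain w where w: "w \<in> f {v}" by blast
    then obtain B where B: "B \<in> X" "f B = {w}"
      using surj downY[OF fX[OF v], of "{w}"] by blast
    then have "B \<subseteq> {v}" "B \<noteq> {}" using ord v w empty by auto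
    then have "B = {v}" by blast
    then show ?thesis using B by blast
  qed
  then obtain \<phi> where \<phi>: "\<And>v. {v} \<in> X \<Longrightarrow> f {v} = {\<phi> v}" by metis
  have image: "f A = \<phi> ` A" if A: "A \<in> X" for A
  proof (intro equalityI subsetI)
    fix w assume w: "w \<in> f A"
    then obtain B where B: "B \<in> X" "f B = {w}"
      using surj downY[OF fX[OF A], of "{w}"] by blast
    then have BA: "B \<subseteq> A" using ord A w by auto
    have "B \<noteq> {}" using B empty by auto
    then obtain v where v: "v \<in> B" by blast
    then have vX: "{v} \<in> X" using down B by blast
    then have "{\<phi> v} \<subseteq> {w}" using ord B v \<phi>[OF vX]
      by (metis empty_subsetI insert_subset)
    then show "w \<in> \<phi> ` A" using BA v by blast
  next
    fix w assume "w \<in> \<phi> ` A"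
    then obtain v where v: "v \<in> A" "w = \<phi> v" by blast
    then have vX: "{v} \<in> X" using down A by blast
    then have "f {v} \<subseteq> f A" using ord A v by blast
    then show "w \<in> f A" using \<phi>[OF vX] v by simp
  qed
  have "inj_on \<phi> (\<Union>X)"
  proof (rule inj_onI)
    fix u v assume "u \<in> \<Union>X" "v \<in> \<Union>X" "\<phi> u = \<phi> v"
    then have "{u} \<in> X" "{v} \<in> X" using down by blast+
    moreover from this have "f {u} = f {v}" using \<phi> \<open>\<phi> u = \<phi> v\<close> by simp
    ultimately show "u = v" using inj by blast
  qed
  with image show ?thesis by blast
qed

section \<open>Pairs of disjoint Latin hypercubes of order five\<close>

text \<open>
  Vertex \<open>5 * i + x\<close> with \<open>x < 5\<close> has colour \<open>i\<close> and label \<open>x\<close>. It is congruent to its label modulo 5,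
  so labels can be added by adding the vertices themselves.
\<close>

abbreviation colour :: "nat \<Rightarrow> nat" where
  "colour v \<equiv> v div 5"

definition rainbow :: "nat \<Rightarrow> nat set \<Rightarrow> bool" where
  "rainbow d A \<longleftrightarrow> A \<subseteq> {..<5 * d} \<and> inj_on colour A"

text \<open>Transitivity of the iterates forces a permutation of five points to be a single cycle.\<close>

definition five_cycle :: "(nat \<Rightarrow> nat) \<Rightarrow> bool" where
  "five_cycle \<rho> \<longleftrightarrow> bij_betw \<rho> {..<5} {..<5} \<and> (\<forall>a<5. \<forall>b<5. \<exists>n. (\<rho> ^^ n) a = b)"

definition relabel :: "(nat \<Rightarrow> nat) \<Rightarrow> nat \<Rightarrow> nat" where
  "relabel \<rho> v = (if v < 5 then \<rho> v else v)"

text \<open>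
  The two alternatives are membership in the Latin hypercubes \<open>L\<^sub>0\<close> and \<open>L\<^sub>1\<close>.
\<close>

definition facet :: "(nat \<Rightarrow> nat) \<Rightarrow> nat \<Rightarrow> nat set \<Rightarrow> bool" where
  "facet \<rho> d F \<longleftrightarrow> rainbow d F \<and> card F = d \<and>
     (\<Sum>F mod 5 = 0 \<or> sum (relabel \<rho>) F mod 5 = 0)"

definition latin_complex :: "(nat \<Rightarrow> nat) \<Rightarrow> nat \<Rightarrow> nat set set" where
  "latin_complex \<rho> d = {A. \<exists>F. facet \<rho> d F \<and> A \<subseteq> F}"

lemma rainbow_subset: "rainbow d A \<Longrightarrow> B \<subseteq> A \<Longrightarrow> rainbow d B"
  unfolding rainbow_def by (meson inj_on_subset subset_trans)

lemma rainbow_finite: "rainbow d A \<Longrightarrow> finite A"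
  unfolding rainbow_def by (meson finite_lessThan finite_subset)

lemma rainbow_colours: "rainbow d A \<Longrightarrow> colour ` A \<subseteq> {..<d}"
  by (auto simp: rainbow_def less_mult_imp_div_less mult.commute)

lemma rainbow_card_colours: "rainbow d A \<Longrightarrow> card (colour ` A) = card A"
  by (simp add: rainbow_def card_image)

lemma rainbow_full:
  assumes "rainbow d F" "card F = d"
  shows "colour ` F = {..<d}"
  using assms rainbow_colours rainbow_card_colours by (intro card_subset_eq) auto

lemma rainbow_insert_iff:
  assumes "v \<notin> A"
  shows "rainbow d (insert v A) \<longleftrightarrow> rainbow d A \<and> colour v < d \<and> colour v \<notin> colour ` A"
proof -
  have bound: "v < 5 * d \<longleftrightarrow> colour v < d"
    by (simp add: div_less_iff_less_mult mult.commute)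
  show ?thesis
    unfolding rainbow_def insert_subset inj_on_insert lessThan_iff bound
      Diff_insert0[OF assms] Diff_empty by blast
qed

text \<open>A ridge misses exactly one colour.\<close>

lemma exchanged_vertices_same_colour:
  assumes "rainbow d (insert v G)" "rainbow d (insert v' G)" "Suc (card G) = d"
    and "v \<notin> G" "v' \<notin> G"
  shows "colour v = colour v'"
proof -
  have "finite G" using rainbow_finite[OF assms(1)] by simp
  then have "insert (colour v) (colour ` G) = {..<d}"
    using rainbow_full[OF assms(1)] assms(3,4) by simp
  moreover have "colour v' < d" "colour v' \<notin> colour ` G"
    using assms(2) rainbow_insert_iff[OF assms(5)] by auto
  ultimately show ?thesis by (metis insertE lessThan_iff)
qed

lemma mod_add_left_imp_eq:
  fixes u v s m :: nat
  assumes "(s + u) mod m = (s + v) mod m"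
  shows "u mod m = v mod m"
proof -
  have "m dvd (s + b) - (s + a)" if "a \<le> b" "(s + a) mod m = (s + b) mod m" for a b
    using that by (metis add_le_cancel_left mod_eq_dvd_iff_nat)
  then show ?thesis
    by (metis assms add_diff_cancel_left mod_eq_dvd_iff_nat nat_le_linear)
qed

lemma same_colour_congruent:
  fixes u v s :: nat
  assumes "colour u = colour v" "(s + u) mod 5 = (s + v) mod 5"
  shows "u = v"
  using assms(1) mod_add_left_imp_eq[OF assms(2)] by (metis div_mult_mod_eq)

lemma complete_sum:
  fixes s i :: nat
  shows "\<exists>v. colour v = i \<and> (s + v) mod 5 = 0"
proof -
  \<comment> \<open>Modulo 5, the label \<open>4 * s\<close> is the negative of \<open>s\<close>.\<close>
  have "colour (5 * i + (4 * s) mod 5) = i" by simp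
  moreover have "(s + (5 * i + (4 * s) mod 5)) mod 5 = 0"
  proof -
    have "(s + (5 * i + (4 * s) mod 5)) mod 5 = ((s + 5 * i) + 4 * s) mod 5"
      by (metis add.assoc mod_add_right_eq)
    also have "\<dots> = 5 * (s + i) mod 5" by (simp add: algebra_simps)
    finally show ?thesis by simp
  qed
  ultimately show ?thesis by (intro exI conjI)
qed

lemma sum_relabel_uncoloured:
  assumes "0 \<notin> colour ` G"
  shows "sum (relabel \<rho>) G = \<Sum>G"
proof (intro sum.cong refl)
  fix x assume "x \<in> G"
  then have "\<not> x < 5" using assms by (metis div_less imageI)
  then show "relabel \<rho> x = x" by (simp add: relabel_def)
qed

text \<open>Only the vertex \<open>z\<close> of colour 0 is affected by the relabelling.\<close>

lemma sum_relabel_split: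
  assumes "rainbow d G" "0 \<in> colour ` G"
  obtains z s where "z < 5" "\<Sum>G = s + z" "sum (relabel \<rho>) G = s + \<rho> z"
proof -
  obtain z where z: "z \<in> G" "colour z = 0" using assms(2) by (metis imageE)
  then have "z < 5" by (simp add: div_eq_0_iff)
  define H where "H = G - {z}"
  have H: "G = insert z H" "z \<notin> H" using z by (auto simp: H_def)
  have "finite H" using rainbow_finite[OF assms(1)] by (simp add: H_def)
  have "0 \<notin> colour ` H"
    using assms(1) z(2) rainbow_insert_iff[OF H(2)] unfolding H(1) by metis
  then have "sum (relabel \<rho>) H = \<Sum>H" by (rule sum_relabel_uncoloured)
  moreover have "relabel \<rho> z = \<rho> z" using \<open>z < 5\<close> by (simp add: relabel_def)
  ultimately have "\<Sum>G = \<Sum>H + z" "sum (relabel \<rho>) G = \<Sum>H + \<rho> z"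
    using H \<open>finite H\<close> by simp_all
  then show thesis by (rule that[OF \<open>z < 5\<close>])
qed

text \<open>As 5 is prime, \<open>e\<close> has an inverse \<open>g\<close> modulo 5, and \<open>b\<close> is reached from \<open>a\<close> in \<open>(b - a) * g\<close> steps.\<close>

lemma translation_transitive:
  fixes e a b :: nat
  assumes "e mod 5 \<noteq> 0" "a < 5" "b < 5"
  shows "\<exists>n. ((\<lambda>k. (k + e) mod 5) ^^ n) a = b"
proof -
  have pow: "((\<lambda>k. (k + e) mod 5) ^^ n) a = (a + n * e) mod 5" for n
  proof (induction n)
    case 0
    then show ?case using \<open>a < 5\<close> by simp
  next
    case (Suc n)
    have "((\<lambda>k. (k + e) mod 5) ^^ Suc n) a = ((a + n * e) mod 5 + e) mod 5"
      using Suc by simp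
    also have "\<dots> = (a + n * e + e) mod 5" by (rule mod_add_left_eq)
    finally show ?case by (simp add: ac_simps)
  qed
  have "e mod 5 = 1 \<or> e mod 5 = 2 \<or> e mod 5 = 3 \<or> e mod 5 = 4"
    using assms(1) by linarith
  then have "\<exists>g. e * g mod 5 = 1"
  proof (elim disjE)
    assume "e mod 5 = 1" then show ?thesis by (intro exI[of _ 1]) simp
  next
    assume "e mod 5 = 2" then show ?thesis by (intro exI[of _ 3]) (simp add: mod_mult_left_eq[of e, symmetric])
  next
    assume "e mod 5 = 3" then show ?thesis by (intro exI[of _ 2]) (simp add: mod_mult_left_eq[of e, symmetric])
  next
    assume "e mod 5 = 4" then show ?thesis by (intro exI[of _ 4]) (simp add: mod_mult_left_eq[of e, symmetric])
  qed
  then obtain g where g: "e * g mod 5 = 1" by blast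
  \<comment> \<open>The summand 5 keeps the difference \<open>b - a\<close> from being truncated at 0.\<close>
  define q m where "q = e * g div 5" and "m = b + 5 - a"
  have eg: "e * g = 5 * q + 1" using g mult_div_mod_eq[of 5 "e * g"] by (simp add: q_def)
  have "a + m = b + 5" using \<open>a < 5\<close> by (simp add: m_def)
  moreover have "m * g * e = m * (e * g)" by (simp add: ac_simps)
  ultimately have "a + m * g * e = b + 5 * (1 + m * q)"
    unfolding eg by (simp add: algebra_simps)
  then have "(a + m * g * e) mod 5 = b"
    using \<open>b < 5\<close> by (metis mod_less mod_mult_self2)
  then have "((\<lambda>k. (k + e) mod 5) ^^ (m * g)) a = b" unfolding pow .
  then show ?thesis by (rule exI)
qed

locale latin_pair =
  fixes \<rho> :: "nat \<Rightarrow> nat" and d :: nat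
  assumes cycle: "five_cycle \<rho>" and dim: "d \<ge> 3"
begin

lemma rho_less: "k < 5 \<Longrightarrow> \<rho> k < 5"
  using cycle by (auto simp: five_cycle_def bij_betw_def)

lemma rho_no_fixpoint:
  assumes "k < 5"
  shows "\<rho> k \<noteq> k"
proof
  assume "\<rho> k = k"
  then have "(\<rho> ^^ n) k = k" for n by (induction n) auto
  moreover have "\<exists>n. (\<rho> ^^ n) k = (if k = 0 then 1 else 0)"
    using cycle assms by (simp add: five_cycle_def)
  ultimately show False by (metis zero_neq_one)
qed

lemma complete_relabelled_sum:
  "\<exists>v. colour v = i \<and> (s + relabel \<rho> v) mod 5 = 0"
proof (cases "i = 0")
  case True
  obtain v where v: "colour v = 0" "(s + v) mod 5 = 0" using complete_sum by metis
  then have "v < 5" by (simp add: div_eq_0_iff)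
  then have "v \<in> \<rho> ` {..<5}" using cycle by (simp add: five_cycle_def bij_betw_def)
  then obtain k where "k < 5" "v = \<rho> k" by (metis imageE lessThan_iff)
  then have "colour k = i \<and> (s + relabel \<rho> k) mod 5 = 0"
    using v(2) True by (simp add: relabel_def)
  then show ?thesis by (rule exI)
next
  case False
  obtain v where v: "colour v = i" "(s + v) mod 5 = 0" using complete_sum by metis
  then have "\<not> v < 5" using False by (metis div_less)
  then have "colour v = i \<and> (s + relabel \<rho> v) mod 5 = 0"
    using v by (simp add: relabel_def)
  then show ?thesis by (rule exI)
qed

lemma same_colour_relabel_congruent:
  assumes "colour u = colour v" "(s + relabel \<rho> u) mod 5 = (s + relabel \<rho> v) mod 5"
  shows "u = v"
proof -
  have "colour (relabel \<rho> u) = colour (relabel \<rho> v)"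
    using assms(1) by (simp add: relabel_def rho_less) (metis div_less rho_less)
  then have eq: "relabel \<rho> u = relabel \<rho> v"
    using assms(2) by (rule same_colour_congruent)
  have "u < 5 \<longleftrightarrow> v < 5" using assms(1) by (metis div_eq_0_iff zero_neq_numeral)
  show ?thesis
  proof (cases "u < 5")
    case True
    then have "\<rho> u = \<rho> v" "u \<in> {..<5}" "v \<in> {..<5}"
      using eq \<open>u < 5 \<longleftrightarrow> v < 5\<close> by (simp_all add: relabel_def)
    then show ?thesis
      using cycle unfolding five_cycle_def bij_betw_def by (metis inj_onD)
  next
    case False
    then show ?thesis using eq \<open>u < 5 \<longleftrightarrow> v < 5\<close> by (simp add: relabel_def)
  qed
qed

lemma relabel_changes_sum:
  assumes "rainbow d G" "0 \<in> colour ` G"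
  shows "\<Sum>G mod 5 \<noteq> sum (relabel \<rho>) G mod 5"
proof
  assume eq: "\<Sum>G mod 5 = sum (relabel \<rho>) G mod 5"
  obtain z s where "z < 5" "\<Sum>G = s + z" "sum (relabel \<rho>) G = s + \<rho> z"
    using sum_relabel_split[OF assms] .
  then have "(s + z) mod 5 = (s + \<rho> z) mod 5" using eq by simp
  moreover have "colour z = colour (\<rho> z)" using rho_less[OF \<open>z < 5\<close>] \<open>z < 5\<close> by simp
  ultimately show False
    using same_colour_congruent rho_no_fixpoint[OF \<open>z < 5\<close>] by metis
qed

text \<open>The two Latin hypercubes are disjoint.\<close>

lemma facet_not_both:
  assumes "rainbow d F" "card F = d" "\<Sum>F mod 5 = 0" "sum (relabel \<rho>) F mod 5 = 0"
  shows False
proof -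
  have "0 \<in> colour ` F" using rainbow_full[OF assms(1,2)] dim by simp
  then show False using relabel_changes_sum[OF assms(1)] assms(3,4) by simp
qed

text \<open>
  A ridge misses one colour \<open>i\<close>, and each of the two Latin hypercubes completes it by exactly one vertex
  of colour \<open>i\<close>. The two completions differ because the hypercubes are disjoint.
\<close>

lemma ridge_facets:
  assumes G: "rainbow d G" and "Suc (card G) = d"
  shows "card {F. facet \<rho> d F \<and> G \<subseteq> F} = 2"
proof -
  have fin: "finite G" using G by (rule rainbow_finite)
  have "colour ` G \<noteq> {..<d}"
    using rainbow_card_colours[OF G] assms(2) by (metis card_lessThan n_not_Suc_n)
  then obtain i where i: "i < d" "i \<notin> colour ` G"
    using rainbow_colours[OF G] by (metis lessThan_iff subsetI subset_antisym)
  obtain v where v: "colour v = i" "(\<Sum>G + v) mod 5 = 0" using complete_sum by metis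
  obtain w where w: "colour w = i" "(sum (relabel \<rho>) G + relabel \<rho> w) mod 5 = 0"
    using complete_relabelled_sum by metis
  have vw: "v \<notin> G" "w \<notin> G" using v(1) w(1) i(2) by (metis imageI)+
  have full: "rainbow d (insert u G) \<and> card (insert u G) = d" if "colour u = i" "u \<notin> G" for u
    using that G i assms(2) fin by (simp add: rainbow_insert_iff)
  have fv: "facet \<rho> d (insert v G)"
    using full[of v] v vw fin by (simp add: facet_def add.commute)
  have fw: "facet \<rho> d (insert w G)"
    using full[of w] w vw fin by (simp add: facet_def add.commute)
  have "v \<noteq> w"
  proof
    assume "v = w"
    then show False
      using facet_not_both[of "insert v G"] full[of v] v w vw fin by (simp add: add.commute)
  qed
  then have ne: "insert v G \<noteq> insert w G" using vw by auto
  have "F = insert v G \<or> F = insert w G" if F: "facet \<rho> d F" "G \<subseteq> F" for F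
  proof -
    have "finite F" using F(1) by (auto simp: facet_def intro: rainbow_finite)
    then obtain u where u: "F = insert u G" "u \<notin> G"
      using facet_insert_ridge[of F G] F assms(2) unfolding facet_def by metis
    have rF: "rainbow d (insert u G)" using F(1) u by (simp add: facet_def)
    have cu: "colour u = i"
      using exchanged_vertices_same_colour[OF rF _ assms(2) u(2) vw(1)] full[of v] v vw by simp
    have "(\<Sum>G + u) mod 5 = 0 \<or> (sum (relabel \<rho>) G + relabel \<rho> u) mod 5 = 0"
      using F(1) u fin by (simp add: facet_def add.commute)
    then have "u = v \<or> u = w"
      using same_colour_congruent[of u v "\<Sum>G"] v
        same_colour_relabel_congruent[of u w "sum (relabel \<rho>) G"] w cu by metis
    then show ?thesis using u by auto
  qed
  then have "{F. facet \<rho> d F \<and> G \<subseteq> F} = {insert v G, insert w G}"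
    using fv fw by blast
  then show ?thesis using ne by simp
qed

lemma rainbow_extends:
  assumes "rainbow d A" "card A < d"
  shows "\<exists>F. facet \<rho> d F \<and> A \<subseteq> F"
  using assms
proof (induction "d - card A" arbitrary: A rule: less_induct)
  case less
  show ?case
  proof (cases "Suc (card A) = d")
    case True
    then have "{F. facet \<rho> d F \<and> A \<subseteq> F} \<noteq> {}" using ridge_facets[OF less.prems(1)]
      by (metis card.empty zero_neq_numeral)
    then show ?thesis by blast
  next
    case False
    have "colour ` A \<noteq> {..<d}"
      using rainbow_card_colours[OF less.prems(1)] less.prems(2) by (metis card_lessThan less_irrefl)
    then obtain i where i: "i < d" "i \<notin> colour ` A"
      using rainbow_colours[OF less.prems(1)] by (metis lessThan_iff subsetI subset_antisym)
    have ci: "colour (5 * i) = i" by simp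
    then have n: "5 * i \<notin> A" using i by (metis imageI)
    have "rainbow d (insert (5 * i) A)"
      using i less.prems(1) unfolding rainbow_insert_iff[OF n] ci by simp
    moreover have "card (insert (5 * i) A) = Suc (card A)"
      using n rainbow_finite[OF less.prems(1)] by simp
    ultimately have "\<exists>F. facet \<rho> d F \<and> insert (5 * i) A \<subseteq> F"
      using less.hyps[of "insert (5 * i) A"] less.prems(2) False by simp
    then show ?thesis by blast
  qed
qed

lemma face_rainbow: "A \<in> latin_complex \<rho> d \<Longrightarrow> rainbow d A"
  unfolding latin_complex_def facet_def using rainbow_subset by blast

lemma face_card_le: "A \<in> latin_complex \<rho> d \<Longrightarrow> card A \<le> d"
  unfolding latin_complex_def facet_def using card_mono rainbow_finite by blast

lemma face_of_card_iff_facet: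
  "A \<in> latin_complex \<rho> d \<and> card A = d \<longleftrightarrow> facet \<rho> d A"
proof
  assume A: "A \<in> latin_complex \<rho> d \<and> card A = d"
  then obtain F where F: "facet \<rho> d F" "A \<subseteq> F" by (auto simp: latin_complex_def)
  then have "A = F" using A by (intro card_subset_eq) (auto simp: facet_def intro: rainbow_finite)
  then show "facet \<rho> d A" using F by simp
qed (auto simp: latin_complex_def facet_def)

text \<open>Below the top dimension the complex does not depend on \<open>\<rho>\<close>.\<close>

lemma small_face_iff_rainbow:
  assumes "card A < d"
  shows "A \<in> latin_complex \<rho> d \<longleftrightarrow> rainbow d A"
  using assms face_rainbow rainbow_extends by (auto simp: latin_complex_def)

lemma facets_eq: "faces (int d - 1) (latin_complex \<rho> d) = {F. facet \<rho> d F}"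
  using face_of_card_iff_facet by (auto simp: faces_def face_dim_def)

lemma simplicial: "simplicial_complex (latin_complex \<rho> d)"
proof -
  have "latin_complex \<rho> d \<subseteq> Pow {..<5 * d}"
    using face_rainbow by (auto simp: rainbow_def)
  then have "finite (latin_complex \<rho> d)" by (rule finite_subset) simp
  moreover have "{} \<in> latin_complex \<rho> d"
    using small_face_iff_rainbow[of "{}"] dim by (simp add: rainbow_def)
  moreover have "B \<in> latin_complex \<rho> d" if "A \<in> latin_complex \<rho> d" "B \<subseteq> A" for A B
    using that unfolding latin_complex_def by blast
  ultimately show ?thesis
    unfolding simplicial_complex_def using face_rainbow rainbow_finite by blast
qed

lemma pseudomanifold_latin_complex: "pseudomanifold (int d - 1) (latin_complex \<rho> d)"
proof -
  let ?X = "latin_complex \<rho> d"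
  have pure: "pure_complex (int d - 1) ?X"
    unfolding pure_complex_def facets_eq by (auto simp: latin_complex_def)
  have empty: "{} \<in> ?X" using simplicial by (simp add: simplicial_complex_def)
  then obtain F where F: "F \<in> faces (int d - 1) ?X"
    using pure by (auto simp: pure_complex_def)
  have "complex_dim ?X = int d - 1"
    unfolding complex_dim_def
  proof (rule Max_eqI)
    show "finite (face_dim ` ?X)" using simplicial by (simp add: simplicial_complex_def)
    show "y \<le> int d - 1" if "y \<in> face_dim ` ?X" for y
      using that by (fastforce simp: face_dim_def dest: face_card_le)
    show "int d - 1 \<in> face_dim ` ?X" using F unfolding faces_def by force
  qed
  moreover have "card {F \<in> faces (int d - 1) ?X. G \<subseteq> F} = 2"
    if G: "G \<in> faces (int d - 1 - 1) ?X" for G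
  proof -
    have "rainbow d G" "Suc (card G) = d"
      using G dim face_rainbow by (auto simp: faces_def face_dim_def)
    then show ?thesis using ridge_facets unfolding facets_eq by simp
  qed
  ultimately show ?thesis
    using simplicial pure by (simp add: pseudomanifold_def)
qed

lemma orientable_latin_complex: "orientable (int d - 1) (latin_complex \<rho> d)"
proof (rule balanced_alternating_orientable[where col = colour and sg = "\<lambda>F. \<Sum>F mod 5 = 0"])
  show "2 \<le> d" using dim by simp
next
  fix F assume "F \<in> faces (int d - 1) (latin_complex \<rho> d)"
  then have "rainbow d F" "card F = d" by (auto simp: facets_eq facet_def)
  then show "bij_betw colour F {..<d}"
    using rainbow_full by (auto simp: bij_betw_def rainbow_def)
next
  fix G F F'
  assume G: "G \<in> faces (int d - 2) (latin_complex \<rho> d)"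
    and F: "F \<in> faces (int d - 1) (latin_complex \<rho> d)"
    and F': "F' \<in> faces (int d - 1) (latin_complex \<rho> d)"
    and ne: "F \<noteq> F'" "G \<subseteq> F" "G \<subseteq> F'"
  have f: "facet \<rho> d F" "facet \<rho> d F'" using F F' facets_eq by auto
  then have fin: "finite F" "finite F'" by (auto simp: facet_def intro: rainbow_finite)
  have cG: "Suc (card G) = d" using G dim by (auto simp: faces_def face_dim_def)
  obtain v v' where v: "F = insert v G" "F' = insert v' G" "v \<notin> G" "v' \<notin> G"
    using facet_insert_ridge[of F G] facet_insert_ridge[of F' G] fin ne(2,3) cG f
    unfolding facet_def by metis
  have vv: "v \<noteq> v'" using v ne by auto
  have finG: "finite G" using fin(1) ne(2) finite_subset by blast
  have c: "colour v = colour v'"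
    using exchanged_vertices_same_colour[of d v G v'] f v cG by (simp add: facet_def)
  show "(\<Sum>F mod 5 = 0) \<noteq> (\<Sum>F' mod 5 = 0)"
  proof
    assume eq: "(\<Sum>F mod 5 = 0) = (\<Sum>F' mod 5 = 0)"
    show False
    proof (cases "\<Sum>F mod 5 = 0")
      case True
      then have "(\<Sum>G + v) mod 5 = (\<Sum>G + v') mod 5"
        using eq v finG by (simp add: add.commute)
      then show False using same_colour_congruent[OF c] vv by blast
    next
      case False
      then have "sum (relabel \<rho>) F mod 5 = 0" "sum (relabel \<rho>) F' mod 5 = 0"
        using f eq by (auto simp: facet_def)
      then have "(sum (relabel \<rho>) G + relabel \<rho> v) mod 5 = (sum (relabel \<rho>) G + relabel \<rho> v') mod 5"
        using v finG by (simp add: add.commute)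
      then show False using same_colour_relabel_congruent[OF c] vv by blast
    qed
  qed
qed

text \<open>
  If \<open>G\<close> misses at least three colours, then two vertices of the link have a common neighbour in a third
  colour \<open>i\<close>. If \<open>G\<close> misses exactly the colours \<open>i\<close> and \<open>j\<close>, then a vertex of colour \<open>j\<close> has exactly two
  neighbours of colour \<open>i\<close>, one through each hypercube. Choosing the names such that \<open>j \<noteq> 0\<close>, the
  passage from one of these neighbours to the other permutes the labels of colour \<open>i\<close> by \<open>\<pi>\<close>: this is
  \<open>\<rho>\<close> if \<open>i = 0\<close>, and otherwise translation by the difference \<open>z - \<rho> z \<noteq> 0\<close> caused by the vertex
  \<open>z\<close> of colour 0 in \<open>G\<close>. In both cases the five vertices of colour \<open>i\<close> form one orbit.
\<close>

lemma link_connected: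
  assumes G: "rainbow d G" and "card G + 2 \<le> d"
  shows "complex_connected (link G (latin_complex \<rho> d))"
proof -
  let ?X = "latin_complex \<rho> d"
  define R where "R = {(x, y). {x, y} \<in> link G ?X}"
  have fin: "finite G" using G by (rule rainbow_finite)
  have edge: "(x, y) \<in> R" if "insert x (insert y G) \<in> ?X" "x \<notin> G" "y \<notin> G" for x y
  proof -
    have "{x, y} = insert x (insert y G) - G" using that by auto
    then show ?thesis using that unfolding R_def link_def by blast
  qed
  have sym: "sym (R\<^sup>*)"
    by (intro sym_rtrancl) (auto simp: sym_def R_def insert_commute)
  have vertex: "u \<notin> G" "colour u < d" "colour u \<notin> colour ` G"
    if u: "u \<in> \<Union>(link G ?X)" for u
  proof -
    obtain A where A: "A \<in> ?X" "G \<subseteq> A" "u \<in> A" "u \<notin> G"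
      using u unfolding link_def by blast
    then show "u \<notin> G" by simp
    have "rainbow d (insert u G)"
      using rainbow_subset[OF face_rainbow[OF A(1)]] A by simp
    then show "colour u < d" "colour u \<notin> colour ` G"
      using rainbow_insert_iff[OF A(4)] by auto
  qed
  have "(u, v) \<in> R\<^sup>*" if u: "u \<in> \<Union>(link G ?X)" and v: "v \<in> \<Union>(link G ?X)" for u v
  proof (cases "card G + 2 < d")
    case True
    have "card (insert (colour u) (insert (colour v) (colour ` G))) \<le> card G + 2"
      using rainbow_card_colours[OF G] fin by (simp add: card_insert_if)
    then have ne: "insert (colour u) (insert (colour v) (colour ` G)) \<noteq> {..<d}"
      using True by (metis card_lessThan leD)
    then obtain i where i: "i < d" "i \<notin> insert (colour u) (insert (colour v) (colour ` G))"
    proof -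
      have "insert (colour u) (insert (colour v) (colour ` G)) \<subseteq> {..<d}"
        using vertex[OF u] vertex[OF v] rainbow_colours[OF G] by simp
      then show ?thesis using that ne by (metis lessThan_iff subsetI subset_antisym)
    qed
    define w where "w = 5 * i"
    have w: "colour w = i" by (simp add: w_def)
    then have wG: "w \<notin> G" using i(2) by (metis imageI insertCI)
    have "insert x (insert w G) \<in> ?X"
      if x: "x \<notin> G" "colour x < d" "colour x \<notin> colour ` G" "colour x \<noteq> i" for x
    proof -
      have ne: "x \<notin> insert w G" using x(1,4) w by (metis insertE)
      have "rainbow d (insert x (insert w G))"
        unfolding rainbow_insert_iff[OF ne] rainbow_insert_iff[OF wG]
        using x w i G by simp
      moreover have "card (insert x (insert w G)) < d"
        using ne wG fin True by simp
      ultimately show ?thesis using small_face_iff_rainbow by blast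
    qed
    then have "(u, w) \<in> R" "(v, w) \<in> R"
      using edge[OF _ _ wG] vertex[OF u] vertex[OF v] i(2) by (metis insertCI)+
    then have "(u, w) \<in> R\<^sup>*" "(w, v) \<in> R\<^sup>*"
      using symD[OF sym] by (metis r_into_rtrancl)+
    then show ?thesis by (rule rtrancl_trans)
  next
    case False
    then have cG: "card G + 2 = d" using assms(2) by simp
    define M where "M = {..<d} - colour ` G"
    have "card M = 2"
      using rainbow_colours[OF G] rainbow_card_colours[OF G] cG
      by (simp add: M_def card_Diff_subset fin)
    then obtain p q where pq: "M = {p, q}" "p \<noteq> q" by (metis card_2_iff)
    obtain i j where ij: "M = {i, j}" "i \<noteq> j" "j \<noteq> 0"
    proof (cases "q = 0")
      case True
      then show ?thesis using that[of q p] pq by auto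
    next
      case False
      then show ?thesis using that[of p q] pq by auto
    qed
    have im: "i < d" "j < d" "i \<notin> colour ` G" "j \<notin> colour ` G"
      using ij(1) unfolding M_def by auto
    define S where "S = \<Sum>G"
    define T where "T = sum (relabel \<rho>) G"
    have edge_ij: "(x, y) \<in> R"
      if xy: "colour x = i" "colour y = j"
        and s: "(S + x + y) mod 5 = 0 \<or> (T + relabel \<rho> x + y) mod 5 = 0" for x y
    proof -
      have n: "y \<notin> G" "x \<notin> G" using xy im by (metis imageI)+
      then have n': "x \<notin> insert y G" using xy ij(2) by (metis insertE)
      have y: "relabel \<rho> y = y" using xy(2) ij(3) by (metis div_less relabel_def)
      have "rainbow d (insert x (insert y G))"
        unfolding rainbow_insert_iff[OF n'] rainbow_insert_iff[OF n(1)]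
        using G xy im ij(2) by simp
      moreover have "card (insert x (insert y G)) = d" using n n' fin cG by simp
      moreover have "\<Sum>(insert x (insert y G)) = S + x + y"
        "sum (relabel \<rho>) (insert x (insert y G)) = T + relabel \<rho> x + y"
        using n n' fin y by (simp_all add: S_def T_def ac_simps)
      ultimately have "facet \<rho> d (insert x (insert y G))"
        using s unfolding facet_def by metis
      then have "insert x (insert y G) \<in> ?X" using face_of_card_iff_facet by blast
      then show ?thesis using edge n by blast
    qed
    obtain \<pi> where trans: "\<And>a b. a < 5 \<Longrightarrow> b < 5 \<Longrightarrow> \<exists>n. (\<pi> ^^ n) a = b"
      and step: "\<And>k. k < 5 \<Longrightarrow> \<pi> k < 5 \<and> (5 * i + k, 5 * i + \<pi> k) \<in> R\<^sup>*"
    proof (cases "i = 0")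
      case True
      have "T = S" using sum_relabel_uncoloured im(3) unfolding S_def T_def True .
      have "\<rho> k < 5 \<and> (5 * i + k, 5 * i + \<rho> k) \<in> R\<^sup>*" if k: "k < 5" for k
      proof -
        obtain y where y: "colour y = j" "(S + \<rho> k + y) mod 5 = 0" using complete_sum by metis
        have "(k, y) \<in> R" "(\<rho> k, y) \<in> R"
          using edge_ij[of k y] edge_ij[of "\<rho> k" y] y True k rho_less[OF k] \<open>T = S\<close>
          by (simp_all add: relabel_def)
        then have "(k, \<rho> k) \<in> R\<^sup>*" using sym by (meson symD r_into_rtrancl rtrancl_trans)
        then show ?thesis using rho_less[OF k] True by simp
      qed
      then show ?thesis using that[of \<rho>] cycle by (auto simp: five_cycle_def)
    next
      case False
      have "0 < d" using dim by simp
      then have "0 \<in> colour ` G" using False ij(1,3) unfolding M_def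
        by (metis Diff_iff insertE lessThan_iff singletonD)
      then have ne: "S mod 5 \<noteq> T mod 5" using relabel_changes_sum[OF G] unfolding S_def T_def by metis
      \<comment> \<open>Modulo 5, this is \<open>S - T\<close>.\<close>
      define e where "e = S + 4 * T"
      have e: "e mod 5 \<noteq> 0"
      proof
        assume "e mod 5 = 0"
        then have "(4 * T + S) mod 5 = (4 * T + T) mod 5" by (simp add: e_def add.commute)
        then show False using ne mod_add_left_imp_eq by metis
      qed
      have "(5 * i + k, 5 * i + (k + e) mod 5) \<in> R\<^sup>*" if k: "k < 5" for k
      proof -
        obtain y where y: "colour y = j" "(S + (5 * i + k) + y) mod 5 = 0"
          using complete_sum by metis
        have "relabel \<rho> (5 * i + (k + e) mod 5) = 5 * i + (k + e) mod 5"
          using False by (simp add: relabel_def)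
        moreover have "(T + (5 * i + (k + e) mod 5) + y) mod 5 = 0"
        proof -
          have "(T + (5 * i + (k + e) mod 5) + y) mod 5 = (T + 5 * i + y + (k + e) mod 5) mod 5"
            by (simp add: ac_simps)
          also have "\<dots> = (T + 5 * i + y + (k + e)) mod 5" by (rule mod_add_right_eq)
          also have "T + 5 * i + y + (k + e) = (S + (5 * i + k) + y) + 5 * T" by (simp add: e_def)
          finally show ?thesis using y(2) by simp
        qed
        ultimately have "(5 * i + (k + e) mod 5, y) \<in> R"
          using edge_ij[of "5 * i + (k + e) mod 5" y] y(1) by simp
        moreover have "(5 * i + k, y) \<in> R" using edge_ij[of "5 * i + k" y] y k by simp
        ultimately show ?thesis using sym by (meson symD r_into_rtrancl rtrancl_trans)
      qed
      then show ?thesis using that[of "\<lambda>k. (k + e) mod 5"] translation_transitive[OF e] by simp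
    qed
    have power: "(\<pi> ^^ n) k < 5 \<and> (5 * i + k, 5 * i + (\<pi> ^^ n) k) \<in> R\<^sup>*" if "k < 5" for n k
    proof (induction n)
      case 0
      then show ?case using that by simp
    next
      case (Suc n)
      then show ?case using step[of "(\<pi> ^^ n) k"] by (auto intro: rtrancl_trans)
    qed
    have block: "(x, y) \<in> R\<^sup>*" if "colour x = i" "colour y = i" for x y
    proof -
      have xy: "x = 5 * i + x mod 5" "y = 5 * i + y mod 5"
        using that mult_div_mod_eq[of 5 x] mult_div_mod_eq[of 5 y] by simp_all
      obtain n where "(\<pi> ^^ n) (x mod 5) = y mod 5" using trans[of "x mod 5" "y mod 5"] by auto
      then show ?thesis using power[of "x mod 5" n] xy by simp
    qed
    have reach: "\<exists>x. colour x = i \<and> (w, x) \<in> R\<^sup>*" if w: "w \<in> \<Union>(link G ?X)" for w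
    proof -
      have "colour w \<in> M" using vertex[OF w] by (simp add: M_def)
      then consider "colour w = i" | "colour w = j" using ij(1) by blast
      then show ?thesis
      proof cases
        case 1
        then show ?thesis by blast
      next
        case 2
        obtain x where x: "colour x = i" "(S + w + x) mod 5 = 0" using complete_sum by metis
        then have "(x, w) \<in> R" using edge_ij[of x w] 2 by (simp add: ac_simps)
        then show ?thesis using x(1) symD[OF sym] by (metis r_into_rtrancl)
      qed
    qed
    obtain x y where "colour x = i" "(u, x) \<in> R\<^sup>*" "colour y = i" "(v, y) \<in> R\<^sup>*"
      using reach u v by blast
    then show ?thesis using block[of x y] sym by (meson symD rtrancl_trans)
  qed
  then show ?thesis unfolding complex_connected_def R_def by blast
qed

lemma normal_pseudomanifold_latin_complex:
  "normal_pseudomanifold (int d - 1) (latin_complex \<rho> d)"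
proof -
  have "link {} (latin_complex \<rho> d) = latin_complex \<rho> d" by (auto simp: link_def)
  then have "complex_connected (latin_complex \<rho> d)"
    using link_connected[of "{}"] dim by (simp add: rainbow_def)
  moreover have "complex_connected (link G (latin_complex \<rho> d))"
    if "k \<in> {0..int d - 1 - 2}" "G \<in> faces k (latin_complex \<rho> d)" for k G
    using that by (intro link_connected) (auto simp: faces_def face_dim_def face_rainbow)
  ultimately show ?thesis
    using pseudomanifold_latin_complex by (simp add: normal_pseudomanifold_def)
qed

lemma skeleton_latin_complex:
  "faces_between 0 (int d - 2) (latin_complex \<rho> d) = {A. rainbow d A \<and> 0 < card A \<and> card A < d}"
proof -
  have "A \<in> faces_between 0 (int d - 2) (latin_complex \<rho> d) \<longleftrightarrow>
      A \<in> latin_complex \<rho> d \<and> 0 < card A \<and> card A < d" for A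
    by (auto simp: faces_between_def faces_def face_dim_def)
  then show ?thesis using small_face_iff_rainbow by blast
qed

end

section \<open>Two inequivalent five-cycles\<close>

definition rotation :: "nat \<Rightarrow> nat" where
  "rotation k = (k + 1) mod 5"

text \<open>
  This is the cycle \<open>0 \<mapsto> 1 \<mapsto> 2 \<mapsto> 4 \<mapsto> 3 \<mapsto> 0\<close>, whose steps \<open>1, 1, 2, -1, 2\<close> are not constant modulo 5.
\<close>

definition twist :: "nat \<Rightarrow> nat" where
  "twist k = [1, 2, 4, 0, 3] ! k"

lemma lessThan_five: "{..<5::nat} = {0, 1, 2, 3, 4}"
  by auto

lemma five_cycle_rotation: "five_cycle rotation"
proof -
  have "bij_betw rotation {..<5} {..<5}"
    unfolding bij_betw_def lessThan_five by (auto simp: rotation_def)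
  moreover have "rotation = (\<lambda>k. (k + 1) mod 5)" by (simp add: rotation_def fun_eq_iff)
  ultimately show ?thesis
    using translation_transitive[of 1] unfolding five_cycle_def by simp
qed

lemma five_cycle_twist: "five_cycle twist"
proof -
  have "bij_betw twist {..<5} {..<5}"
    unfolding bij_betw_def lessThan_five by (auto simp: twist_def)
  moreover have "\<exists>n\<in>{0, 1, 2, 3, 4}. (twist ^^ n) a = b" if "a \<in> {..<5}" "b \<in> {..<5}" for a b
    using that unfolding lessThan_five
    by (elim insertE emptyE; simp add: twist_def numeral_eq_Suc)
  ultimately show ?thesis unfolding five_cycle_def by (metis lessThan_iff)
qed

text \<open>Here membership in \<open>L\<^sub>1\<close> says that the sum becomes 0 when 1 is added.\<close>

lemma rotation_facet_sum:
  assumes "facet rotation d F" "d \<ge> 1"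
  shows "\<Sum>F mod 5 \<in> {0, 4}"
proof -
  have F: "rainbow d F" "card F = d" using assms(1) by (auto simp: facet_def)
  have "0 \<in> colour ` F" using rainbow_full[OF F] assms(2) by simp
  then obtain z s where zs: "\<Sum>F = s + z" "sum (relabel rotation) F = s + rotation z"
    using sum_relabel_split[OF F(1)] by metis
  moreover have "(s + (z + 1) mod 5) mod 5 = (s + z + 1) mod 5"
    using mod_add_right_eq[of s "z + 1" 5] by (simp add: ac_simps)
  ultimately have sums: "\<Sum>F mod 5 = 0 \<or> (\<Sum>F + 1) mod 5 = 0"
    using assms(1) unfolding facet_def rotation_def by metis
  have "\<Sum>F mod 5 < 5" by simp
  then show ?thesis using sums by (auto simp: mod_Suc split: if_splits)
qed

text \<open>
  Each exchange of a vertex preserves its colour and switches the sum between 0 and \<open>-1\<close>. Along the path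
  the sum before the first exchange is therefore the sum after the last one, and the sums next to the
  middle position agree as well; so \<open>b + c\<close> and \<open>b' + c'\<close> are congruent modulo 5, and then so are \<open>a\<close>
  and \<open>a''\<close>. The hypotheses mention only vertices and facets, so an isomorphism of
  face posets transports them.
\<close>

lemma rotation_path_closes:
  fixes a a' a'' b b' c c' :: nat
  assumes "card R + 3 = d"
    and f: "facet rotation d (insert a (insert b (insert c R)))"
      "facet rotation d (insert a' (insert b (insert c R)))"
      "facet rotation d (insert a' (insert b' (insert c R)))"
      "facet rotation d (insert a' (insert b' (insert c' R)))"
      "facet rotation d (insert a'' (insert b' (insert c' R)))"
    and ne: "a \<noteq> a'" "b \<noteq> b'" "c \<noteq> c'" "a' \<noteq> a''"
  shows "a'' = a"
proof -
  have fin: "finite R"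
    using f(1) unfolding facet_def by (auto dest: rainbow_finite)
  have distinct: "x \<notin> R \<and> y \<notin> R \<and> z \<notin> R \<and> x \<noteq> y \<and> x \<noteq> z \<and> y \<noteq> z"
    if "facet rotation d (insert x (insert y (insert z R)))" for x y z
    using that assms(1) fin by (auto simp: facet_def card_insert_if split: if_splits)
  note D = f[THEN distinct]
  have D': "b \<noteq> a'" "b' \<noteq> a'" "c \<noteq> a'" "c \<noteq> b'" "c' \<noteq> a'" "c' \<noteq> b'"
    using D by metis+
  have flip: "colour v = colour v' \<and> {(\<Sum>G + v) mod 5, (\<Sum>G + v') mod 5} = {0, 4}"
    if "facet rotation d (insert v G)" "facet rotation d (insert v' G)" "v \<notin> G" "v' \<notin> G" "v \<noteq> v'"
    for v v' G
  proof -
    have G: "finite G" using that(1) unfolding facet_def by (auto dest: rainbow_finite)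
    then have cG: "Suc (card G) = d" using that(1,3) by (simp add: facet_def)
    have c: "colour v = colour v'"
      using exchanged_vertices_same_colour[of d v G v'] that cG by (simp add: facet_def)
    then have "(\<Sum>G + v) mod 5 \<noteq> (\<Sum>G + v') mod 5"
      using same_colour_congruent that(5) by blast
    moreover have "(\<Sum>G + v) mod 5 \<in> {0, 4}" "(\<Sum>G + v') mod 5 \<in> {0, 4}"
      using rotation_facet_sum[OF that(1)] rotation_facet_sum[OF that(2)] that(3,4) G cG
      by (simp_all add: add.commute)
    ultimately show ?thesis using c by auto
  qed
  define r where "r = \<Sum>R"
  have 1: "colour a = colour a' \<and> {(r + a + b + c) mod 5, (r + a' + b + c) mod 5} = {0, 4}"
    using flip[OF f(1,2)] D ne fin by (simp add: r_def ac_simps)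
  have 2: "{(r + a' + b + c) mod 5, (r + a' + b' + c) mod 5} = {0, 4}"
    using flip[of b "insert a' (insert c R)" b'] f(2,3) D D' ne fin
    by (simp add: r_def ac_simps insert_commute)
  have 3: "{(r + a' + b' + c) mod 5, (r + a' + b' + c') mod 5} = {0, 4}"
    using flip[of c "insert a' (insert b' R)" c'] f(3,4) D D' ne fin
    by (simp add: r_def ac_simps insert_commute)
  have 4: "colour a' = colour a'' \<and> {(r + a' + b' + c') mod 5, (r + a'' + b' + c') mod 5} = {0, 4}"
    using flip[OF f(4,5)] D ne fin by (simp add: r_def ac_simps)
  have "(r + a' + b + c) mod 5 = (r + a' + b' + c') mod 5"
    "(r + a + b + c) mod 5 = (r + a'' + b' + c') mod 5"
    using 1 2 3 4 by (auto simp: doubleton_eq_iff)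
  then have p: "(a' + (r + b + c)) mod 5 = (a' + (r + b' + c')) mod 5"
    and q: "((r + b + c) + a) mod 5 = ((r + b' + c') + a'') mod 5"
    by (simp_all add: ac_simps)
  have "((r + b' + c') + a) mod 5 = ((r + b' + c') + a'') mod 5"
    using mod_add_cong[OF mod_add_left_imp_eq[OF p] refl] q by metis
  moreover have "colour a = colour a''" using 1 4 by simp
  ultimately show ?thesis using same_colour_congruent by metis
qed

text \<open>
  The remaining colours are occupied by their vertices with label 0, so only \<open>a\<close>, \<open>b\<close> and \<open>c\<close>
  contribute to the sums.
\<close>

lemma twist_facet:
  assumes "d \<ge> 3" "colour a = 1" "colour b = 2" "colour c = 0"
    and s: "(a + b + c) mod 5 = 0 \<or> (a + b + twist c) mod 5 = 0"
  shows "facet twist d (insert a (insert b (insert c ((\<lambda>i. 5 * i) ` {3..<d}))))"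
proof -
  define R where "R = (\<lambda>i. 5 * i :: nat) ` {3..<d}"
  have cR: "colour ` R = {3..<d}" by (simp add: R_def image_image)
  have R: "rainbow d R" by (auto simp: R_def rainbow_def inj_on_def)
  have "card R = d - 3" by (simp add: R_def card_image inj_on_def)
  have "\<Sum>R = 5 * (\<Sum>i\<in>{3..<d}. i)"
    by (simp add: R_def sum.reindex inj_on_def sum_distrib_left)
  then have sR: "(\<Sum>R) mod 5 = 0" by simp
  have wR: "sum (relabel twist) R = \<Sum>R" using sum_relabel_uncoloured cR by simp
  have n: "c \<notin> R" "b \<notin> insert c R" "a \<notin> insert b (insert c R)"
    using assms(2-4) by (auto simp: R_def)
  have "rainbow d (insert a (insert b (insert c R)))"
    using assms(1-4) R cR by (simp add: rainbow_insert_iff[OF n(1)] rainbow_insert_iff[OF n(2)]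
        rainbow_insert_iff[OF n(3)])
  moreover have "card (insert a (insert b (insert c R))) = d"
    using n assms(1) \<open>card R = d - 3\<close> rainbow_finite[OF R] by simp
  moreover have "relabel twist a = a" "relabel twist b = b" "relabel twist c = twist c"
    using assms(2-4) by (auto simp: relabel_def)
  then have "\<Sum>(insert a (insert b (insert c R))) = \<Sum>R + (a + b + c)"
    "sum (relabel twist) (insert a (insert b (insert c R))) = \<Sum>R + (a + b + twist c)"
    using n rainbow_finite[OF R] wR by simp_all
  then have "\<Sum>(insert a (insert b (insert c R))) mod 5 = 0 \<or>
      sum (relabel twist) (insert a (insert b (insert c R))) mod 5 = 0"
    using s sR by (metis add_0 mod_add_left_eq)
  ultimately show ?thesis by (simp add: facet_def R_def)
qed

theorem theorem6p8:
  fixes d :: nat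
  assumes "d \<ge> 3"
  shows "\<exists>(X :: nat set set) (Y :: nat set set).
    normal_pseudomanifold (int d - 1) X \<and> orientable (int d - 1) X \<and>
    normal_pseudomanifold (int d - 1) Y \<and> orientable (int d - 1) Y \<and>
    poset_isomorphic (faces_between 0 (int d - 2) X) (faces_between 0 (int d - 2) Y) \<and>
    \<not> poset_isomorphic X Y"
proof -
  interpret T: latin_pair twist d using five_cycle_twist assms by unfold_locales
  interpret S: latin_pair rotation d using five_cycle_rotation assms by unfold_locales
  let ?X = "latin_complex twist d" and ?Y = "latin_complex rotation d"
  have "poset_isomorphic (faces_between 0 (int d - 2) ?X) (faces_between 0 (int d - 2) ?Y)"
    unfolding poset_isomorphic_def T.skeleton_latin_complex S.skeleton_latin_complex
    by (rule exI[of _ id]) (simp add: bij_betw_def)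
  moreover have "\<not> poset_isomorphic ?X ?Y"
  proof
    assume "poset_isomorphic ?X ?Y"
    then obtain f where bij: "bij_betw f ?X ?Y"
      and ord: "\<forall>A\<in>?X. \<forall>B\<in>?X. A \<subseteq> B \<longleftrightarrow> f A \<subseteq> f B"
      unfolding poset_isomorphic_def by blast
    obtain \<phi> where inj: "inj_on \<phi> (\<Union>?X)" and \<phi>: "\<forall>A\<in>?X. f A = \<phi> ` A"
      using face_poset_isomorphism_vertex_map[OF T.simplicial S.simplicial bij ord] by blast
    have f: "f A \<in> ?Y" if "A \<in> ?X" for A
      using bij that by (rule bij_betw_apply)
    define R where "R = (\<lambda>i. 5 * i :: nat) ` {3..<d}"
    have facet: "insert a (insert b (insert c R)) \<in> ?X \<and>
        facet rotation d (insert (\<phi> a) (insert (\<phi> b) (insert (\<phi> c) (\<phi> ` R))))"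
      if "colour a = 1" "colour b = 2" "colour c = 0"
        "(a + b + c) mod 5 = 0 \<or> (a + b + twist c) mod 5 = 0" for a b c
    proof -
      let ?F = "insert a (insert b (insert c R))"
      have F: "?F \<in> ?X" "card ?F = d"
        using twist_facet[OF assms that] T.face_of_card_iff_facet by (auto simp: R_def)
      have "card (\<phi> ` ?F) = d"
        using card_image[OF inj_on_subset[OF inj Union_upper[OF F(1)]]] F(2) by (rule trans)
      moreover have "\<phi> ` ?F \<in> ?Y" using \<phi> F(1) f[OF F(1)] by simp
      ultimately have "facet rotation d (\<phi> ` ?F)" using S.face_of_card_iff_facet by blast
      then show ?thesis using F(1) by simp
    qed
    \<comment> \<open>The labels of colours 1, 2, 0 run through \<open>(0, 0, 3)\<close>, \<open>(2, 0, 3)\<close>, \<open>(2, 3, 3)\<close>,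
      \<open>(2, 3, 0)\<close>, \<open>(1, 3, 0)\<close>. Colour 1 moves by \<open>0 - 3\<close>, the step of the twist out of 3, and later
      back by 1, its step out of 0; the sum of the two displacements is not 0.\<close>
    have f1: "insert 5 (insert 10 (insert 3 R)) \<in> ?X \<and>
        facet rotation d (insert (\<phi> 5) (insert (\<phi> 10) (insert (\<phi> 3) (\<phi> ` R))))"
      by (rule facet) (simp_all add: twist_def)
    have f2: "insert 7 (insert 10 (insert 3 R)) \<in> ?X \<and>
        facet rotation d (insert (\<phi> 7) (insert (\<phi> 10) (insert (\<phi> 3) (\<phi> ` R))))"
      by (rule facet) (simp_all add: twist_def)
    have f3: "insert 7 (insert 13 (insert 3 R)) \<in> ?X \<and>
        facet rotation d (insert (\<phi> 7) (insert (\<phi> 13) (insert (\<phi> 3) (\<phi> ` R))))"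
      by (rule facet) (simp_all add: twist_def)
    have f4: "insert 7 (insert 13 (insert 0 R)) \<in> ?X \<and>
        facet rotation d (insert (\<phi> 7) (insert (\<phi> 13) (insert (\<phi> 0) (\<phi> ` R))))"
      by (rule facet) (simp_all add: twist_def)
    have f5: "insert 6 (insert 13 (insert 0 R)) \<in> ?X \<and>
        facet rotation d (insert (\<phi> 6) (insert (\<phi> 13) (insert (\<phi> 0) (\<phi> ` R))))"
      by (rule facet) (simp_all add: twist_def)
    have V: "5 \<in> \<Union>?X" "6 \<in> \<Union>?X" "7 \<in> \<Union>?X" "10 \<in> \<Union>?X" "13 \<in> \<Union>?X" "0 \<in> \<Union>?X" "3 \<in> \<Union>?X"
      "R \<subseteq> \<Union>?X"
      using f1 f2 f3 f4 f5 by blast+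
    have "card (\<phi> ` R) = card R"
      using inj_on_subset[OF inj V(8)] by (rule card_image)
    also have "card R + 3 = d" using assms by (simp add: R_def card_image inj_on_def)
    finally have "card (\<phi> ` R) + 3 = d" by simp
    moreover have "\<phi> 5 \<noteq> \<phi> 7" "\<phi> 10 \<noteq> \<phi> 13" "\<phi> 3 \<noteq> \<phi> 0" "\<phi> 7 \<noteq> \<phi> 6" "\<phi> 6 \<noteq> \<phi> 5"
      using V by (simp_all add: inj_on_eq_iff[OF inj])
    ultimately show False
      using rotation_path_closes[of "\<phi> ` R" d "\<phi> 5" "\<phi> 10" "\<phi> 3" "\<phi> 7" "\<phi> 13" "\<phi> 0" "\<phi> 6"]
        f1 f2 f3 f4 f5 by blast
  qed
  ultimately show ?thesis
    using T.normal_pseudomanifold_latin_complex T.orientable_latin_complex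
      S.normal_pseudomanifold_latin_complex S.orientable_latin_complex by blast
qed

end
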